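(* For any $\theta\in[-1,1]$, a 2D symmetric OCAD on $\Omega=[-1,1]^2$, both for $\mathbb P^4$ and for $\mathbb P^5$, is given by $$\langle p\rangle_\Omega=\overline\omega_\star\big[(1+\theta)\langle p\rangle_\Omega^x+(1-\theta)\langle p\rangle_\Omega^y\big]+\omega_1\,\overline{p(x^{(1)},y^{(1)})}+\omega_2\,\overline{p(x^{(2)},y^{(2)})}$$ with $$\overline\omega_\star=\Big[\tfrac{14}{3}+\tfrac23\sqrt{78\theta^2+46}\,\cos\Big(\tfrac13\arccos\tfrac{1476\,\theta^2-244}{(78\theta^2+46)^{3/2}}\Big)\Big]^{-1},$$ $$\omega_1=\frac{5(1-4\overline\omega_\star+2|\theta|\overline\omega_\star)^2}{9(1-6\overline\omega_\star+4|\theta|\overline\omega_\star)},\qquad \omega_2=1-2\overline\omega_\star-\omega_1,$$ and, for $\theta\in[-1,0]$, $$(x^{(1)},y^{(1)})=\Big(\sqrt{\tfrac{3(1-6\overline\omega_\star+4|\theta|\overline\omega_\star)}{5(1-4\overline\omega_\star+2|\theta|\overline\omega_\star)}},\ \sqrt{\tfrac{1-6\overline\omega_\star}{3(1-4\overline\omega_\star+2|\theta|\overline\omega_\star)}}\Big),\qquad (x^{(2)},y^{(2)})=\Big(0,\ \sqrt{\tfrac{1-4\overline\omega_\star-2|\theta|\overline\omega_\star-3\omega_1(y^{(1)})^2}{3\omega_2}}\Big),$$ while, for $\theta\in[0,1]$, $$(x^{(1)},y^{(1)})=\Big(\sqrt{\tfrac{1-6\overline\omega_\star}{3(1-4\overline\omega_\star+2|\theta|\overline\omega_\star)}},\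 \sqrt{\tfrac{3(1-6\overline\omega_\star+4|\theta|\overline\omega_\star)}{5(1-4\overline\omega_\star+2|\theta|\overline\omega_\star)}}\Big),\qquad (x^{(2)},y^{(2)})=\Big(\sqrt{\tfrac{1-4\overline\omega_\star-2|\theta|\overline\omega_\star-3\omega_1(x^{(1)})^2}{3\omega_2}},\ 0\Big).$$ Moreover, for all $\theta\in[-1,1]$ and $k\in\{4,5\}$, $\overline\omega_\star(\theta,\mathbb P^k)=\phi^\star(\theta,\mathbb P^k_+)=\phi^\star(\theta,(\mathbb P^2)^2)$, and there exists a critical positive polynomial for $\phi^\star(\theta,\mathbb P^k_+)$ of the form $q_\star^2$ with $q_\star\in\mathbb P^2\setminus\{0\}$.
   Context: $\mathbb P^k$: real polynomials in $(x,y)$ of total degree at most $k$. $\langle p\rangle_\Omega=\frac14\iint_\Omega p$, $\langle p\rangle_\Omega^x=\frac14\int_{-1}^1[p(-1,y)+p(1,y)]dy$, $\langle p\rangle_\Omega^y=\frac14\int_{-1}^1[p(x,-1)+p(x,1)]dx$, $\overline{p(a,b)}=\frac14[p(a,b)+p(-a,b)+p(a,-b)+p(-a,-b)]$. A feasible symmetric CAD for $(\theta,\mathbb P^k)$ with boundary weight $\overline\omega$ is an identity $\langle p\rangle_\Omega=\overline\omega[(1+\theta)\langle p\rangle_\Omega^x+(1-\theta)\langle p\rangle_\Omega^y]+\sum_{s=1}^S\omega_s\overline{p(x^{(s)},y^{(s)})}$ valid for all $p\in\mathbb P^k$, with $S\ge0$ finite, $\overline\omega>0$, all $\omega_s>0$,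 all $(x^{(s)},y^{(s)})\in[0,1]^2$. $\overline\omega_\star(\theta,\mathbb P^k)$ is the maximum of $\overline\omega$ over all such CADs, and a symmetric OCAD is one attaining it. $\mathbb P^k_+=\{p\in\mathbb P^k:p\ge0\text{ on }\Omega\}$. For $p\in\mathbb P_+^k$, $\phi(p;\theta)=\dfrac{\langle p\rangle_\Omega}{(1+\theta)\langle p\rangle_\Omega^x+(1-\theta)\langle p\rangle_\Omega^y}$ if the denominator is nonzero, $+\infty$ otherwise; $\phi^\star(\theta,\mathbb P^k_+)=\inf_{p\in\mathbb P^k_+}\phi(p;\theta)$ and $\phi^\star(\theta,(\mathbb P^m)^2)=\inf_{q\in\mathbb P^m}\phi(q^2;\theta)$. A critical positive polynomial for $\phi^\star(\theta,\mathbb P^k_+)$ is a $p^\star\in\mathbb P^k_+\setminus\{0\}$ with $\phi(p^\star;\theta)=\phi^\star(\theta,\mathbb P^k_+)$. *)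

theory Defs
  imports "HOL-Analysis.Analysis"
begin

text \<open>Bivariate real polynomials are represented by their polynomial functions on the plane
  (over the reals, a polynomial and its function determine each other).\<close>

definition polys :: "nat \<Rightarrow> (real \<times> real \<Rightarrow> real) set" where
  "polys k = {p. \<exists>c :: nat \<Rightarrow> nat \<Rightarrow> real.
      p = (\<lambda>(x, y). \<Sum>i\<le>k. \<Sum>j\<le>k - i. c i j * x ^ i * y ^ j)}"

definition Omega :: "(real \<times> real) set" where
  "Omega = {-1..1} \<times> {-1..1}"

definition nonneg_polys :: "nat \<Rightarrow> (real \<times> real \<Rightarrow> real) set" where
  "nonneg_polys k = {p \<in> polys k. \<forall>z\<in>Omega. p z \<ge> 0}"

definition squares :: "(real \<times> real \<Rightarrow> real) set \<Rightarrow> (real \<times> real \<Rightarrow> real) set" where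
  "squares V = (\<lambda>q z. (q z)\<^sup>2) ` V"

definition cell_avg :: "(real \<times> real \<Rightarrow> real) \<Rightarrow> real" where
  "cell_avg p = 1/4 * integral Omega p"

definition x_edge_avg :: "(real \<times> real \<Rightarrow> real) \<Rightarrow> real" where
  "x_edge_avg p = 1/4 * integral {-1..1} (\<lambda>y. p (-1, y) + p (1, y))"

definition y_edge_avg :: "(real \<times> real \<Rightarrow> real) \<Rightarrow> real" where
  "y_edge_avg p = 1/4 * integral {-1..1} (\<lambda>x. p (x, -1) + p (x, 1))"

definition edge_avg :: "real \<Rightarrow> (real \<times> real \<Rightarrow> real) \<Rightarrow> real" where
  "edge_avg \<theta> p = (1 + \<theta>) * x_edge_avg p + (1 - \<theta>) * y_edge_avg p"

definition sym_avg :: "(real \<times> real \<Rightarrow> real) \<Rightarrow> real \<Rightarrow> real \<Rightarrow> real" where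
  "sym_avg p a b = 1/4 * (p (a, b) + p (-a, b) + p (a, -b) + p (-a, -b))"

text \<open>A symmetric CAD is given by its boundary weight \<open>w\<close> and the list of its interior
  weights and nodes \<open>(\<omega>, x, y)\<close>; the list may be empty.\<close>

definition feasible_symmetric_CAD ::
  "real \<Rightarrow> (real \<times> real \<Rightarrow> real) set \<Rightarrow> real \<Rightarrow> (real \<times> real \<times> real) list \<Rightarrow> bool" where
  "feasible_symmetric_CAD \<theta> V w ns \<longleftrightarrow>
     w > 0 \<and>
     (\<forall>(\<omega>, x, y) \<in> set ns. \<omega> > 0 \<and> x \<in> {0..1} \<and> y \<in> {0..1}) \<and>
     (\<forall>p\<in>V. cell_avg p = w * edge_avg \<theta> p + (\<Sum>(\<omega>, x, y)\<leftarrow>ns. \<omega> * sym_avg p x y))"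

text \<open>The maximal boundary weight; it is meaningful only when the maximum exists, which
  any OCAD (below) witnesses.\<close>

definition omega_star :: "real \<Rightarrow> (real \<times> real \<Rightarrow> real) set \<Rightarrow> real" where
  "omega_star \<theta> V = (GREATEST w. \<exists>ns. feasible_symmetric_CAD \<theta> V w ns)"

text \<open>Optimality is stated directly as attaining the maximum, so that it does not rely on
  \<^const>\<open>omega_star\<close> being well defined.\<close>

definition symmetric_OCAD ::
  "real \<Rightarrow> (real \<times> real \<Rightarrow> real) set \<Rightarrow> real \<Rightarrow> (real \<times> real \<times> real) list \<Rightarrow> bool" where
  "symmetric_OCAD \<theta> V w ns \<longleftrightarrow>
     feasible_symmetric_CAD \<theta> V w ns \<and>
     (\<forall>w' ns'. feasible_symmetric_CAD \<theta> V w' ns' \<longrightarrow> w' \<le> w)"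

definition phi :: "(real \<times> real \<Rightarrow> real) \<Rightarrow> real \<Rightarrow> ereal" where
  "phi p \<theta> = (if edge_avg \<theta> p \<noteq> 0 then ereal (cell_avg p / edge_avg \<theta> p) else \<infinity>)"

definition phi_star :: "real \<Rightarrow> (real \<times> real \<Rightarrow> real) set \<Rightarrow> ereal" where
  "phi_star \<theta> V = (INF p\<in>V. phi p \<theta>)"

definition critical_positive_poly :: "real \<Rightarrow> nat \<Rightarrow> (real \<times> real \<Rightarrow> real) \<Rightarrow> bool" where
  "critical_positive_poly \<theta> k p \<longleftrightarrow>
     p \<in> nonneg_polys k - {\<lambda>z. 0} \<and> phi p \<theta> = phi_star \<theta> (nonneg_polys k)"

end

theory Submission
  imports Defs
begin

text \<open>
  A symmetric CAD only sees the monomials that are even in both variables, so on \<open>polys 5\<close> (as on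
  \<open>polys 4\<close>) it amounts to six moment equations. Two nodes, one of them on a coordinate axis, can
  satisfy them only if the matrix of the form cell average minus \<open>w\<close> times edge average on the
  span of \<open>1\<close>, \<open>x\<^sup>2\<close>, \<open>y\<^sup>2\<close> is singular. In \<open>u = 1 / w\<close> this is a cubic equation, and
  the trigonometric formula gives its largest root.
  Optimality comes from the even quadratic \<open>q\<close> that vanishes at all nodes: the CAD identity reduces
  to cell average equals \<open>w\<close> times edge average for \<open>q\<^sup>2\<close>, whereas every feasible weight is a
  lower bound for this ratio over all nonnegative polynomials.
\<close>

section \<open>Closure of the polynomial spaces under sums and products\<close>

lemma polys_add: "p \<in> polys k \<Longrightarrow> q \<in> polys k \<Longrightarrow> (\<lambda>z. p z + q z) \<in> polys k"
proof -
  assume "p \<in> polys k" "q \<in> polys k"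
  then obtain c d where "p = (\<lambda>(x, y). \<Sum>i\<le>k. \<Sum>j\<le>k - i. c i j * x ^ i * y ^ j)"
    "q = (\<lambda>(x, y). \<Sum>i\<le>k. \<Sum>j\<le>k - i. d i j * x ^ i * y ^ j)"
    by (auto simp: polys_def)
  hence "(\<lambda>z. p z + q z)
      = (\<lambda>(x, y). \<Sum>i\<le>k. \<Sum>j\<le>k - i. (c i j + d i j) * x ^ i * y ^ j)"
    by (auto simp: fun_eq_iff sum.distrib distrib_right)
  thus ?thesis unfolding polys_def mem_Collect_eq by (intro exI[of _ "\<lambda>i j. c i j + d i j"])
qed

lemma polys_monom:
  assumes "i + j \<le> k"
  shows "(\<lambda>(x, y). c * x ^ i * y ^ j) \<in> polys k"
proof -
  define d where "d i' j' = (if i' = i then if j' = j then c else 0 else 0)" for i' j'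
  have "(\<Sum>i'\<le>k. \<Sum>j'\<le>k - i'. d i' j' * x ^ i' * y ^ j') = c * x ^ i * y ^ j" for x y
  proof -
    \<comment> \<open>The two tests are swapped so that the inner sum over \<open>j'\<close>
      collapses first; its range matters only at \<open>i' = i\<close>, where
      \<open>i + j \<le> k\<close> puts \<open>j\<close> into it.\<close>
    have "d i' j' * x ^ i' * y ^ j' = (if j' = j then if i' = i then c * x ^ i * y ^ j else 0 else 0)"
      for i' j' by (simp add: d_def)
    hence "(\<Sum>i'\<le>k. \<Sum>j'\<le>k - i'. d i' j' * x ^ i' * y ^ j')
        = (\<Sum>i'\<le>k. if i' = i then c * x ^ i * y ^ j else 0)"
      using assms by (intro sum.cong) auto
    also have "\<dots> = c * x ^ i * y ^ j" using assms by simp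
    finally show ?thesis .
  qed
  thus ?thesis unfolding polys_def by (auto simp: fun_eq_iff intro!: exI[of _ d])
qed

lemma polys_sum:
  assumes "finite I" "\<And>i. i \<in> I \<Longrightarrow> f i \<in> polys k"
  shows "(\<lambda>z. \<Sum>i\<in>I. f i z) \<in> polys k"
  using assms
proof (induction I)
  case empty
  show ?case using polys_monom[of 0 0 k 0] by (simp add: case_prod_unfold)
next
  case (insert i I)
  thus ?case by (simp add: polys_add)
qed

lemma polys_mono:
  assumes "k \<le> l" shows "polys k \<subseteq> polys l"
proof
  fix p assume "p \<in> polys k"
  then obtain c where p: "p = (\<lambda>(x, y). \<Sum>i\<le>k. \<Sum>j\<le>k - i. c i j * x ^ i * y ^ j)"
    by (auto simp: polys_def)
  have "(\<lambda>z. \<Sum>i\<le>k. \<Sum>j\<le>k - i. (\<lambda>(x, y). c i j * x ^ i * y ^ j) z) \<in> polys l"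
    using assms by (intro polys_sum polys_monom) auto
  thus "p \<in> polys l" by (simp add: p case_prod_unfold)
qed

lemma polys_mult:
  assumes "p \<in> polys k" "q \<in> polys l"
  shows "(\<lambda>z. p z * q z) \<in> polys (k + l)"
proof -
  obtain c d where p: "p = (\<lambda>(x, y). \<Sum>i\<le>k. \<Sum>j\<le>k - i. c i j * x ^ i * y ^ j)"
    and q: "q = (\<lambda>(x, y). \<Sum>i\<le>l. \<Sum>j\<le>l - i. d i j * x ^ i * y ^ j)"
    using assms by (auto simp: polys_def)
  have "(\<lambda>z. \<Sum>i\<le>k. \<Sum>i'\<le>l. \<Sum>j\<le>k - i. \<Sum>j'\<le>l - i'.
      (\<lambda>(x, y). (c i j * d i' j') * x ^ (i + i') * y ^ (j + j')) z) \<in> polys (k + l)"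
    by (intro polys_sum polys_monom) auto
  moreover have "(\<lambda>z. p z * q z) = (\<lambda>z. \<Sum>i\<le>k. \<Sum>i'\<le>l. \<Sum>j\<le>k - i. \<Sum>j'\<le>l - i'.
      (\<lambda>(x, y). (c i j * d i' j') * x ^ (i + i') * y ^ (j + j')) z)"
    by (auto simp: p q fun_eq_iff sum_product power_add mult_ac)
  ultimately show ?thesis by simp
qed

lemma continuous_on_polys: "p \<in> polys k \<Longrightarrow> continuous_on S p"
  by (auto simp: polys_def case_prod_beta intro!: continuous_intros)

lemma Omega_eq_cbox: "Omega = cbox (-1, -1) (1, 1)"
  by (simp add: Omega_def cbox_Pair_eq)

section \<open>Moments of monomials over the cell, the edges and the nodes\<close>

text \<open>The mean of \<open>x ^ n\<close> over the points -1 and 1; equally the factor that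
  averaging over \<open>a\<close> and \<open>-a\<close> puts in front of
  \<open>a ^ n\<close>.\<close>

definition vertex_moment :: "nat \<Rightarrow> real" where
  "vertex_moment n = (1 + (-1) ^ n) / 2"

text \<open>The mean of \<open>x ^ n\<close> over [-1, 1], so that averages of monomials become
  products of one-dimensional means.\<close>

definition interval_moment :: "nat \<Rightarrow> real" where
  "interval_moment n = (1 + (-1) ^ n) / (2 * (1 + real n))"

lemma has_integral_power_symmetric:
  "((\<lambda>x::real. x ^ n) has_integral 2 * interval_moment n) {-1..1}"
proof -
  have "((\<lambda>x::real. x ^ n) has_integral 1 ^ Suc n / (1 + real n) - (-1) ^ Suc n / (1 + real n)) {-1..1}"
  proof (intro fundamental_theorem_of_calculus)
    fix x :: real
    have "((\<lambda>x. x ^ Suc n / (1 + real n)) has_real_derivative x ^ n) (at x within {-1..1})"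
      using DERIV_cdivide[OF DERIV_pow[of "Suc n" x "{-1..1}"], of "1 + real n"] by simp
    thus "((\<lambda>x. x ^ Suc n / (1 + real n)) has_vector_derivative x ^ n) (at x within {-1..1})"
      by (simp add: has_real_derivative_iff_has_vector_derivative)
  qed simp
  moreover have "1 ^ Suc n / (1 + real n) - (-1) ^ Suc n / (1 + real n) = 2 * interval_moment n"
    by (simp add: interval_moment_def field_simps)
  ultimately show ?thesis by (simp only:)
qed

lemma sum_list_map_eq_0: "(\<And>x. x \<in> set xs \<Longrightarrow> f x = 0) \<Longrightarrow> (\<Sum>x\<leftarrow>xs. f x) = (0 :: real)"
  by (induction xs) auto

text \<open>Fubini factors each monomial. All the averages are written over the same coefficient
  array, so that a CAD identity can be compared term by term.\<close>

lemma cell_avg_poly: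
  "cell_avg (\<lambda>(x, y). \<Sum>i\<le>k. \<Sum>j\<le>k - i. c i j * x ^ i * y ^ j)
    = (\<Sum>i\<le>k. \<Sum>j\<le>k - i. c i j * (interval_moment i * interval_moment j))"
  (is "cell_avg ?p = _")
proof -
  have "?p \<in> polys k" by (auto simp: polys_def)
  hence "integral Omega ?p = integral {-1..1} (\<lambda>x. integral {-1..1} (\<lambda>y. ?p (x, y)))"
    unfolding Omega_eq_cbox by (subst integral_prod_continuous) (auto intro: continuous_on_polys)
  also have "(\<lambda>x. integral {-1..1} (\<lambda>y. ?p (x, y)))
      = (\<lambda>x. \<Sum>i\<le>k. \<Sum>j\<le>k - i. c i j * x ^ i * (2 * interval_moment j))"
  proof
    fix x :: real
    have "((\<lambda>y. ?p (x, y)) has_integral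
        (\<Sum>i\<le>k. \<Sum>j\<le>k - i. c i j * x ^ i * (2 * interval_moment j))) {-1..1}"
      unfolding prod.case
      by (intro has_integral_sum has_integral_mult_right has_integral_power_symmetric) auto
    thus "integral {-1..1} (\<lambda>y. ?p (x, y))
        = (\<Sum>i\<le>k. \<Sum>j\<le>k - i. c i j * x ^ i * (2 * interval_moment j))"
      by (rule integral_unique)
  qed
  also have "((\<lambda>x. \<Sum>i\<le>k. \<Sum>j\<le>k - i. c i j * x ^ i * (2 * interval_moment j)) has_integral
      (\<Sum>i\<le>k. \<Sum>j\<le>k - i. c i j * (2 * interval_moment i) * (2 * interval_moment j))) {-1..1}"
    by (intro has_integral_sum has_integral_mult_right has_integral_mult_left
        has_integral_power_symmetric) auto
  hence "integral {-1..1} (\<lambda>x. \<Sum>i\<le>k. \<Sum>j\<le>k - i. c i j * x ^ i * (2 * interval_moment j))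
      = (\<Sum>i\<le>k. \<Sum>j\<le>k - i. c i j * (2 * interval_moment i) * (2 * interval_moment j))"
    by (rule integral_unique)
  finally show ?thesis
    by (simp add: cell_avg_def sum_distrib_left mult_ac)
qed

lemma x_edge_avg_poly:
  "x_edge_avg (\<lambda>(x, y). \<Sum>i\<le>k. \<Sum>j\<le>k - i. c i j * x ^ i * y ^ j)
    = (\<Sum>i\<le>k. \<Sum>j\<le>k - i. c i j * (vertex_moment i * interval_moment j))"
proof -
  have "((\<lambda>y. (\<Sum>i\<le>k. \<Sum>j\<le>k - i. c i j * (-1) ^ i * y ^ j)
        + (\<Sum>i\<le>k. \<Sum>j\<le>k - i. c i j * 1 ^ i * y ^ j)) has_integral
      (\<Sum>i\<le>k. \<Sum>j\<le>k - i. c i j * (-1) ^ i * (2 * interval_moment j))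
        + (\<Sum>i\<le>k. \<Sum>j\<le>k - i. c i j * 1 ^ i * (2 * interval_moment j))) {-1..1}"
    by (intro has_integral_add has_integral_sum has_integral_mult_right
        has_integral_power_symmetric) auto
  hence "x_edge_avg (\<lambda>(x, y). \<Sum>i\<le>k. \<Sum>j\<le>k - i. c i j * x ^ i * y ^ j) = 1/4 * ((\<Sum>i\<le>k. \<Sum>j\<le>k - i. c i j * (-1) ^ i * (2 * interval_moment j))
        + (\<Sum>i\<le>k. \<Sum>j\<le>k - i. c i j * 1 ^ i * (2 * interval_moment j)))"
    unfolding x_edge_avg_def prod.case by (simp only: integral_unique)
  also have "\<dots> = (\<Sum>i\<le>k. \<Sum>j\<le>k - i. c i j * (vertex_moment i * interval_moment j))"
    unfolding sum_distrib_left sum.distrib[symmetric]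
    by (intro sum.cong refl) (simp add: vertex_moment_def field_simps)
  finally show ?thesis .
qed

lemma y_edge_avg_poly:
  "y_edge_avg (\<lambda>(x, y). \<Sum>i\<le>k. \<Sum>j\<le>k - i. c i j * x ^ i * y ^ j)
    = (\<Sum>i\<le>k. \<Sum>j\<le>k - i. c i j * (interval_moment i * vertex_moment j))"
proof -
  have "((\<lambda>x. (\<Sum>i\<le>k. \<Sum>j\<le>k - i. c i j * x ^ i * (-1) ^ j)
        + (\<Sum>i\<le>k. \<Sum>j\<le>k - i. c i j * x ^ i * 1 ^ j)) has_integral
      (\<Sum>i\<le>k. \<Sum>j\<le>k - i. c i j * (2 * interval_moment i) * (-1) ^ j)
        + (\<Sum>i\<le>k. \<Sum>j\<le>k - i. c i j * (2 * interval_moment i) * 1 ^ j)) {-1..1}"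
    by (intro has_integral_add has_integral_sum has_integral_mult_right has_integral_mult_left
        has_integral_power_symmetric) auto
  hence "y_edge_avg (\<lambda>(x, y). \<Sum>i\<le>k. \<Sum>j\<le>k - i. c i j * x ^ i * y ^ j) = 1/4 * ((\<Sum>i\<le>k. \<Sum>j\<le>k - i. c i j * (2 * interval_moment i) * (-1) ^ j)
        + (\<Sum>i\<le>k. \<Sum>j\<le>k - i. c i j * (2 * interval_moment i) * 1 ^ j))"
    unfolding y_edge_avg_def prod.case by (simp only: integral_unique)
  also have "\<dots> = (\<Sum>i\<le>k. \<Sum>j\<le>k - i. c i j * (interval_moment i * vertex_moment j))"
    unfolding sum_distrib_left sum.distrib[symmetric]
    by (intro sum.cong refl) (simp add: vertex_moment_def field_simps)
  finally show ?thesis .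
qed

lemma sym_avg_poly:
  "sym_avg (\<lambda>(x, y). \<Sum>i\<le>k. \<Sum>j\<le>k - i. c i j * x ^ i * y ^ j) a b
    = (\<Sum>i\<le>k. \<Sum>j\<le>k - i. c i j * ((vertex_moment i * a ^ i) * (vertex_moment j * b ^ j)))"
proof -
  have "(-a) ^ i = (-1) ^ i * a ^ i" "(-b) ^ i = (-1) ^ i * b ^ i" for i
    by (simp_all flip: power_mult_distrib)
  thus ?thesis
    by (simp add: sym_avg_def vertex_moment_def sum_distrib_left field_simps flip: sum.distrib)
qed

section \<open>Reduction of a CAD identity to six moment equations\<close>

lemma CAD_identity_if_monomials:
  assumes mon: "\<And>i j. i + j \<le> k \<Longrightarrow>
      interval_moment i * interval_moment j
      = w * ((1 + \<theta>) * (vertex_moment i * interval_moment j)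
           + (1 - \<theta>) * (interval_moment i * vertex_moment j))
        + (\<Sum>(\<omega>, x, y)\<leftarrow>ns. \<omega> * ((vertex_moment i * x ^ i) * (vertex_moment j * y ^ j)))"
    and "p \<in> polys k"
  shows "cell_avg p = w * edge_avg \<theta> p + (\<Sum>(\<omega>, x, y)\<leftarrow>ns. \<omega> * sym_avg p x y)"
proof -
  obtain c where p: "p = (\<lambda>(x, y). \<Sum>i\<le>k. \<Sum>j\<le>k - i. c i j * x ^ i * y ^ j)"
    using \<open>p \<in> polys k\<close> by (auto simp: polys_def)
  have nodes: "(\<Sum>(\<omega>, x, y)\<leftarrow>ns. \<omega> * sym_avg p x y)
      = (\<Sum>i\<le>k. \<Sum>j\<le>k - i. c i j *
          (\<Sum>(\<omega>, x, y)\<leftarrow>ns. \<omega> * ((vertex_moment i * x ^ i) * (vertex_moment j * y ^ j))))"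
    unfolding p sym_avg_poly
    by (induction ns)
       (auto simp: sum.distrib sum_distrib_left distrib_left mult_ac split: prod.splits)
  have "cell_avg p = (\<Sum>i\<le>k. \<Sum>j\<le>k - i. c i j * (interval_moment i * interval_moment j))"
    unfolding p cell_avg_poly ..
  also have "\<dots> = (\<Sum>i\<le>k. \<Sum>j\<le>k - i. c i j *
        (w * ((1 + \<theta>) * (vertex_moment i * interval_moment j)
           + (1 - \<theta>) * (interval_moment i * vertex_moment j))
        + (\<Sum>(\<omega>, x, y)\<leftarrow>ns. \<omega> * ((vertex_moment i * x ^ i) * (vertex_moment j * y ^ j)))))"
    by (intro sum.cong refl) (subst mon, auto)
  also have "\<dots> = w * edge_avg \<theta> p + (\<Sum>(\<omega>, x, y)\<leftarrow>ns. \<omega> * sym_avg p x y)"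
    unfolding nodes unfolding edge_avg_def p x_edge_avg_poly y_edge_avg_poly
    unfolding sum_distrib_left sum.distrib[symmetric]
    by (intro sum.cong refl) (simp add: algebra_simps)
  finally show ?thesis .
qed

lemma feasible_symmetric_CAD_mono:
  "feasible_symmetric_CAD \<theta> V w ns \<Longrightarrow> U \<subseteq> V \<Longrightarrow> feasible_symmetric_CAD \<theta> U w ns"
  by (auto simp: feasible_symmetric_CAD_def)

text \<open>Reflection symmetry kills every monomial that is odd in some variable, and up to degree
  5 only six are even in both; degree 5 adds none to degree 4.\<close>

lemma feasible_symmetric_CAD_polys5:
  assumes "w > 0" and ns: "\<And>\<omega> x y. (\<omega>, x, y) \<in> set ns \<Longrightarrow> \<omega> > 0 \<and> x \<in> {0..1} \<and> y \<in> {0..1}"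
    and m00: "(\<Sum>(\<omega>, x, y)\<leftarrow>ns. \<omega>) = 1 - 2 * w"
    and m20: "(\<Sum>(\<omega>, x, y)\<leftarrow>ns. \<omega> * x^2) = (1 - 4 * w - 2 * \<theta> * w) / 3"
    and m02: "(\<Sum>(\<omega>, x, y)\<leftarrow>ns. \<omega> * y^2) = (1 - 4 * w + 2 * \<theta> * w) / 3"
    and m40: "(\<Sum>(\<omega>, x, y)\<leftarrow>ns. \<omega> * x^4) = (1 - 6 * w - 4 * \<theta> * w) / 5"
    and m22: "(\<Sum>(\<omega>, x, y)\<leftarrow>ns. \<omega> * (x^2 * y^2)) = (1 - 6 * w) / 9"
    and m04: "(\<Sum>(\<omega>, x, y)\<leftarrow>ns. \<omega> * y^4) = (1 - 6 * w + 4 * \<theta> * w) / 5"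
  shows "feasible_symmetric_CAD \<theta> (polys 5) w ns"
proof -
  have mon: "interval_moment i * interval_moment j
      = w * ((1 + \<theta>) * (vertex_moment i * interval_moment j)
           + (1 - \<theta>) * (interval_moment i * vertex_moment j))
        + (\<Sum>(\<omega>, x, y)\<leftarrow>ns. \<omega> * ((vertex_moment i * x ^ i) * (vertex_moment j * y ^ j)))"
    if "i + j \<le> 5" for i j
  proof (cases "even i \<and> even j")
    case False
    have "(\<Sum>(\<omega>, x, y)\<leftarrow>ns. \<omega> * ((vertex_moment i * x ^ i) * (vertex_moment j * y ^ j))) = 0"
      using False by (intro sum_list_map_eq_0) (auto simp: vertex_moment_def)
    thus ?thesis using False by (auto simp: vertex_moment_def interval_moment_def)
  next
    case True
    then obtain i' j' where ij: "i = 2 * i'" "j = 2 * j'" by (auto elim!: evenE)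
    with that have "i' + j' \<le> 2" by simp
    hence "(i', j') \<in> {(0,0), (0,1), (0,2), (1,0), (1,1), (2,0)}" by auto
    hence "(i, j) \<in> {(0,0), (0,2), (0,4), (2,0), (2,2), (4,0)}" by (auto simp: ij)
    thus ?thesis
      using m00 m20 m02 m40 m22 m04
      by (auto simp: vertex_moment_def interval_moment_def field_simps)
  qed
  show ?thesis
    unfolding feasible_symmetric_CAD_def
    using \<open>w > 0\<close> ns CAD_identity_if_monomials[OF mon] by auto
qed

section \<open>Weak duality and the optimality certificate\<close>

lemma edge_avg_nonneg:
  assumes "p \<in> nonneg_polys k" "\<bar>\<theta>\<bar> \<le> 1"
  shows "edge_avg \<theta> p \<ge> 0"
proof -
  have cont: "continuous_on UNIV p"
    and nonneg: "\<And>x y. x \<in> {-1..1} \<Longrightarrow> y \<in> {-1..1} \<Longrightarrow> p (x, y) \<ge> 0"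
    using assms(1) by (auto simp: nonneg_polys_def Omega_def intro: continuous_on_polys)
  have "integral {-1..1} (\<lambda>y. p (-1, y) + p (1, y)) \<ge> 0"
    using nonneg
    by (intro integral_nonneg integrable_continuous_real continuous_intros
        continuous_on_compose2[OF cont]) auto
  moreover have "integral {-1..1} (\<lambda>x. p (x, -1) + p (x, 1)) \<ge> 0"
    using nonneg
    by (intro integral_nonneg integrable_continuous_real continuous_intros
        continuous_on_compose2[OF cont]) auto
  ultimately show ?thesis
    using assms(2) by (auto simp: edge_avg_def x_edge_avg_def y_edge_avg_def)
qed

text \<open>A continuous nonnegative function with zero integral over a box with nonempty interior
  vanishes on the box.\<close>

lemma cell_avg_pos:
  assumes "p \<in> nonneg_polys k" "z \<in> Omega" "p z \<noteq> 0"
  shows "cell_avg p > 0"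
proof -
  have cont: "continuous_on (cbox (-1, -1) (1, 1)) p"
    and nonneg: "\<And>z. z \<in> cbox (-1, -1) (1, 1) \<Longrightarrow> p z \<ge> 0"
    using assms(1) by (auto simp: nonneg_polys_def Omega_eq_cbox intro: continuous_on_polys)
  have int: "p integrable_on cbox (-1, -1) (1, 1)" by (rule integrable_continuous[OF cont])
  have "integral Omega p \<noteq> 0"
  proof
    assume "integral Omega p = 0"
    hence "(p has_integral 0) (cbox (-1, -1) (1, 1))"
      using int by (metis Omega_eq_cbox integrable_integral)
    moreover have "\<And>z. z \<in> box (-1, -1) (1, 1) \<Longrightarrow> p z \<ge> 0"
      using nonneg box_subset_cbox by blast
    moreover have "box (-1, -1) (1, 1) \<noteq> ({} :: (real \<times> real) set)"
      by (auto simp: box_ne_empty Basis_prod_def)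
    ultimately have "p z = 0"
      using has_integral_0_cbox_imp_0[OF cont] assms(2) unfolding Omega_eq_cbox by blast
    thus False using assms(3) by simp
  qed
  moreover have "integral Omega p \<ge> 0"
    unfolding Omega_eq_cbox using nonneg by (intro integral_nonneg int) auto
  ultimately show ?thesis by (simp add: cell_avg_def)
qed

lemma sym_avg_nonneg:
  assumes "p \<in> nonneg_polys k" "x \<in> {0..1}" "y \<in> {0..1}"
  shows "sym_avg p x y \<ge> 0"
  using assms by (auto simp: sym_avg_def nonneg_polys_def Omega_def intro!: add_nonneg_nonneg)

text \<open>Weak duality: the node sum is nonnegative, so dropping it bounds the weight by the ratio
  in \<open>phi\<close> whenever the edge average is positive.\<close>

lemma feasible_symmetric_CAD_le:
  assumes "feasible_symmetric_CAD \<theta> (polys k) w ns" "p \<in> nonneg_polys k"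
  shows "w * edge_avg \<theta> p \<le> cell_avg p"
proof -
  have "(\<Sum>(\<omega>, x, y)\<leftarrow>ns. \<omega> * sym_avg p x y) \<ge> 0"
    using assms
    by (intro sum_list_nonneg)
       (auto simp: feasible_symmetric_CAD_def intro!: mult_nonneg_nonneg sym_avg_nonneg)
  thus ?thesis using assms by (auto simp: feasible_symmetric_CAD_def nonneg_polys_def)
qed

lemma squares_subset_nonneg_polys:
  assumes "2 * m \<le> k" shows "squares (polys m) \<subseteq> nonneg_polys k"
proof
  fix p assume "p \<in> squares (polys m)"
  then obtain q where q: "q \<in> polys m" and p: "p = (\<lambda>z. (q z)\<^sup>2)" by (auto simp: squares_def)
  have "p \<in> polys (m + m)" unfolding p power2_eq_square using q q by (rule polys_mult)
  thus "p \<in> nonneg_polys k"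
    using polys_mono[of "m + m" k] assms by (auto simp: nonneg_polys_def p)
qed

text \<open>Complementary slackness: weak duality is an equality for such a square, so a single
  polynomial certifies both the maximal weight and the minimal ratio.\<close>

lemma OCAD_if_square_vanishes_at_nodes:
  assumes feas: "feasible_symmetric_CAD \<theta> (polys k) w ns" and "\<bar>\<theta>\<bar> \<le> 1" "2 * m \<le> k"
    and q: "q \<in> polys m" "z \<in> Omega" "q z \<noteq> 0"
    and nodes: "\<forall>(\<omega>, x, y)\<in>set ns. sym_avg (\<lambda>z. (q z)\<^sup>2) x y = 0"
  shows "symmetric_OCAD \<theta> (polys k) w ns"
    and "omega_star \<theta> (polys k) = w"
    and "phi_star \<theta> (nonneg_polys k) = w"
    and "phi_star \<theta> (squares (polys m)) = w"
    and "critical_positive_poly \<theta> k (\<lambda>z. (q z)\<^sup>2)"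
proof -
  let ?p = "\<lambda>z. (q z)\<^sup>2"
  have sq: "?p \<in> squares (polys m)" using q(1) by (auto simp: squares_def)
  have sub: "squares (polys m) \<subseteq> nonneg_polys k"
    using assms(3) by (rule squares_subset_nonneg_polys)
  have p: "?p \<in> nonneg_polys k" using sq sub by blast
  have "(\<Sum>(\<omega>, x, y)\<leftarrow>ns. \<omega> * sym_avg ?p x y) = 0"
    using nodes by (intro sum_list_map_eq_0) auto
  hence cell: "cell_avg ?p = w * edge_avg \<theta> ?p"
    using feas p by (auto simp: feasible_symmetric_CAD_def nonneg_polys_def)
  moreover have "cell_avg ?p > 0" using q by (intro cell_avg_pos[OF p]) auto
  \<comment> \<open>Positivity of the cell average excludes the infinite value of
    \<open>phi\<close>.\<close>
  ultimately have "edge_avg \<theta> ?p \<noteq> 0" by auto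
  with edge_avg_nonneg[OF p assms(2)] have edge: "edge_avg \<theta> ?p > 0" by simp
  hence phi_p: "phi ?p \<theta> = w" by (simp add: phi_def cell)
  have opt: "w' \<le> w" if "feasible_symmetric_CAD \<theta> (polys k) w' ns'" for w' ns'
    using feasible_symmetric_CAD_le[OF that p] edge by (simp add: cell)
  thus "symmetric_OCAD \<theta> (polys k) w ns" using feas by (auto simp: symmetric_OCAD_def)
  show "omega_star \<theta> (polys k) = w"
    unfolding omega_star_def using feas opt by (intro Greatest_equality) auto
  have lower: "w \<le> phi r \<theta>" if "r \<in> nonneg_polys k" for r
    using feasible_symmetric_CAD_le[OF feas that] edge_avg_nonneg[OF that assms(2)]
    by (auto simp: phi_def field_simps)
  \<comment> \<open>Every family between the single polynomial \<open>?p\<close> and all nonnegative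
    polynomials has the same infimum, which covers the squares as well.\<close>
  have inf: "phi_star \<theta> V = w" if "V \<subseteq> nonneg_polys k" "?p \<in> V" for V
    unfolding phi_star_def
  proof (rule antisym)
    show "(INF r\<in>V. phi r \<theta>) \<le> w" using INF_lower[OF that(2), of "\<lambda>r. phi r \<theta>"] by (simp only: phi_p)
    show "w \<le> (INF r\<in>V. phi r \<theta>)" using lower that(1) by (intro INF_greatest) auto
  qed
  show star: "phi_star \<theta> (nonneg_polys k) = w" using p by (intro inf) auto
  show "phi_star \<theta> (squares (polys m)) = w" using sub sq by (rule inf)
  have "?p \<noteq> (\<lambda>z. 0)" using q(3) by (auto dest: fun_cong[of _ _ z])
  thus "critical_positive_poly \<theta> k ?p"
    using p phi_p star by (simp add: critical_positive_poly_def)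
qed

section \<open>The largest root of the cubic\<close>

text \<open>For \<open>s = \<theta>\<^sup>2\<close> and \<open>v = 1 / w - 14/3\<close> this is
  Viete's solution of a depressed cubic: scaling \<open>v\<close> to \<open>h\<close> gives the
  triple-angle identity. The bound 31/12 amounts to \<open>1 / w > 29/4\<close>.\<close>

lemma trigonometric_cubic_root:
  fixes s v :: real
  assumes s: "s \<ge> 0"
    and v: "v = 2/3 * sqrt (78 * s + 46) *
              cos (1/3 * arccos ((1476 * s - 244) / (78 * s + 46) powr (3/2)))"
  shows "v^3 - (78 * s + 46) / 3 * v = (2952 * s - 488) / 27"
    and "v > 31/12"
proof -
  define r where "r = sqrt (78 * s + 46)"
  define g where "g = (1476 * s - 244) / r^3"
  define h where "h = cos (1/3 * arccos g)"
  have r0: "r > 0" and r2: "r^2 = 78 * s + 46" using s by (auto simp: r_def)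
  have powr: "(78 * s + 46) powr (3/2) = r^3"
    using powr_powr[of "78 * s + 46" "1/2" 3] s r0 by (simp add: r_def powr_half_sqrt)
  have vh: "v = 2/3 * r * h"
    by (simp add: v powr r_def[symmetric] g_def h_def)
  have r6: "(r^3)^2 = (78 * s + 46)^3"
    by (metis r2 power_mult mult.commute)
  \<comment> \<open>This yields \<open>|g| \<le> 1\<close>, the condition for three real roots. The
    quadratic factor has its square completed at 6199/4394, and 37800 is 46^3 - 244^2.\<close>
  have "(78 * s + 46)^3 - (1476 * s - 244)^2
      = s * (474552 * (s - 6199/4394)^2 + (1215432 - 474552 * (6199/4394)^2)) + 37800"
    by (simp add: algebra_simps power2_eq_square power3_eq_cube)
  also have "\<dots> \<ge> 0"
    using s by (intro add_nonneg_nonneg mult_nonneg_nonneg) (auto simp: power2_eq_square)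
  finally have "(1476 * s - 244)^2 \<le> (r^3)^2"
    unfolding r6 by simp
  hence "\<bar>1476 * s - 244\<bar> \<le> r^3"
    using abs_le_square_iff[of "1476 * s - 244" "r^3"] r0 by simp
  hence g: "-1 \<le> g" "g \<le> 1" using r0 by (auto simp: g_def field_simps abs_le_iff)
  have "4 * h^3 - 3 * h = cos (arccos g)"
    unfolding h_def by (simp flip: cos_treble_cos)
  also have "\<dots> = g" using g by simp
  finally have h3: "4 * h^3 - 3 * h = g" .
  have gr: "g * r^3 = 1476 * s - 244" using r0 by (simp add: g_def)
  have "v^3 - r^2 / 3 * v = 2/27 * ((4 * h^3 - 3 * h) * r^3)"
    by (simp add: vh power_mult_distrib field_simps power2_eq_square power3_eq_cube)
  thus cubic: "v^3 - (78 * s + 46) / 3 * v = (2952 * s - 488) / 27"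
    by (simp add: h3 gr r2)
  \<comment> \<open>The angle is at most pi/3, so \<open>v \<ge> r / 3\<close>. The cubic has its
    local minimum at \<open>r / 3\<close> and increases from there, so \<open>v\<close> is its
    largest root.\<close>
  have "cos (pi / 3) \<le> h"
    unfolding h_def using arccos_bounded[OF g] by (intro cos_monotone_0_pi_le) auto
  hence "h \<ge> 1/2" by (simp add: cos_60)
  hence "v \<ge> r / 3" using r0 by (simp add: vh)
  hence "v^2 \<ge> (r / 3)^2" using r0 by (intro power_mono) auto
  hence v2: "3 * v^2 \<ge> (78 * s + 46) / 3" by (simp add: power_divide r2)
  have v0: "v > 0" using \<open>v \<ge> r / 3\<close> r0 by simp
  show "v > 31/12"
  proof (rule ccontr)
    assume "\<not> v > 31/12"
    hence le: "v \<le> 31/12" by simp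
    \<comment> \<open>By this monotonicity, \<open>v \<le> 31/12\<close> would make the value of the
      cubic at 31/12 at least the one at \<open>v\<close>, which fails for
      \<open>s \<ge> 0\<close>.\<close>
    have "(31/12 - v) * ((31/12)^2 + 31/12 * v + v^2 - (78 * s + 46) / 3) \<ge> 0"
    proof (rule mult_nonneg_nonneg)
      have "v * v \<le> 31/12 * v" using le v0 by (intro mult_right_mono) auto
      moreover have "v^2 \<le> (31/12)^2" using le v0 by (intro power_mono) auto
      ultimately show "0 \<le> (31/12)^2 + 31/12 * v + v^2 - (78 * s + 46) / 3"
        using v2 by (simp add: power2_eq_square)
    qed (use le in simp)
    also have "(31/12 - v) * ((31/12)^2 + 31/12 * v + v^2 - (78 * s + 46) / 3)
        = (31/12)^3 - (78 * s + 46) / 3 * (31/12) - (v^3 - (78 * s + 46) / 3 * v)"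
      by algebra
    finally show False unfolding cubic using s by (simp add: field_simps)
  qed
qed

section \<open>Residual moments and the two nodes\<close>

text \<open>\<open>1 - 2 * w\<close>, \<open>a / 3\<close>, \<open>b / 3\<close>, \<open>d / 5\<close>, \<open>c / 9\<close>, \<open>e / 5\<close> are the moments of
  \<open>1\<close>, \<open>x\<^sup>2\<close>, \<open>y\<^sup>2\<close>, \<open>x\<^sup>4\<close>, \<open>x\<^sup>2 y\<^sup>2\<close>, \<open>y\<^sup>4\<close> left to the nodes for
  \<open>\<theta> = -t\<close>; the last conclusion says that their \<open>3 \<times> 3\<close> moment matrix is singular.\<close>

lemma residual_moment_bounds:
  fixes t u w :: real
  assumes t: "0 \<le> t" "t \<le> 1" and u: "u > 29/4" and w: "w = 1 / u"
    and cubic: "(u - 14/3)^3 - (78 * t^2 + 46) / 3 * (u - 14/3) = (2952 * t^2 - 488) / 27"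
  defines "a \<equiv> 1 - 4 * w + 2 * t * w" and "b \<equiv> 1 - 4 * w - 2 * t * w" and "c \<equiv> 1 - 6 * w"
    and "d \<equiv> 1 - 6 * w + 4 * t * w" and "e \<equiv> 1 - 6 * w - 4 * t * w"
  shows "a > 0" "c > 0" "d > 0" "3 * d \<le> 5 * a" "c \<le> 3 * a"
    "9 * (1 - 2 * w) * d > 5 * a^2" "9 * b * d \<ge> 5 * a * c"
    "9 * b * d - 5 * a * c \<le> 27 * (1 - 2 * w) * d - 15 * a^2"
    "((1 - 2 * w) * d - 5 * a^2 / 9) * (e * d / 5 - 5 * c^2 / 81) = (b * d / 3 - 5 * a * c / 27)^2"
proof -
  have w0: "w > 0" and wu: "w * u = 1" using u w by auto
  \<comment> \<open>Writing 1 as \<open>w * u\<close> makes each residual \<open>w\<close> times an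
    affine form in \<open>u\<close> and \<open>t\<close>; the claims become polynomial ones up to a
    power of \<open>w\<close>.\<close>
  have n: "1 - 2 * w = w * (u - 2)" using wu by (simp add: algebra_simps)
  have a: "a = w * (u - 4 + 2 * t)" and b: "b = w * (u - 4 - 2 * t)" and c: "c = w * (u - 6)"
    and d: "d = w * (u - 6 + 4 * t)" and e: "e = w * (u - 6 - 4 * t)"
    using wu by (simp_all add: a_def b_def c_def d_def e_def algebra_simps)
  show "a > 0" "c > 0" "d > 0" using w0 u t by (auto simp: a c d)
  have "5 * a - 3 * d = w * (2 * u - 2 - 2 * t)" "3 * a - c = w * (2 * u - 6 + 6 * t)"
    by (simp_all add: a c d algebra_simps)
  moreover have "w * (2 * u - 2 - 2 * t) \<ge> 0" "w * (2 * u - 6 + 6 * t) \<ge> 0"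
    using w0 u t by auto
  ultimately show "3 * d \<le> 5 * a" "c \<le> 3 * a" by linarith+
  \<comment> \<open>This is 45 times the minor of the moment matrix for 1 and x^2;
    \<open>u > 7\<close> makes the first factor positive.\<close>
  have "9 * (1 - 2 * w) * d - 5 * a^2 = w^2 * (4 * ((u - 7 + 5 * t) * (u - 1 - t)))"
    unfolding n a d by algebra
  also have "\<dots> > 0" using w0 u t by simp
  finally show "9 * (1 - 2 * w) * d > 5 * a^2" by simp
  \<comment> \<open>The square exceeds 4, and the last bracket is nonnegative on [0, 1], vanishing
    at \<open>t = 1\<close>.\<close>
  have "9 * b * d - 5 * a * c = w^2 * (4 * ((u - 5 + t)^2 - 4 + (3 + 16 * t - 19 * t^2)))"
    unfolding a b c d by algebra
  also have "\<dots> \<ge> 0"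
  proof -
    have "(u - 5 + t)^2 \<ge> 2^2" using u t by (intro power_mono) auto
    moreover have "t^2 \<le> t" using t by (simp add: power2_eq_square mult_left_le)
    ultimately show ?thesis using t by (intro mult_nonneg_nonneg) auto
  qed
  finally show "9 * b * d \<ge> 5 * a * c" by simp
  \<comment> \<open>Here the margin over 7 matters: \<open>u > 29/4\<close> gives
    \<open>2 * u * (u - 7) > 3\<close>.\<close>
  have "27 * (1 - 2 * w) * d - 15 * a^2 - (9 * b * d - 5 * a * c)
      = w^2 * (4 * (2 * (u * (u - 7)) - 3 + (10 * (t * u) + 3 * t^2)))"
    unfolding n a b c d by algebra
  also have "\<dots> \<ge> 0"
  proof -
    have "u * (u - 7) \<ge> 29/4 * (1/4)" using u by (intro mult_mono) auto
    moreover have "t * u \<ge> 0" using t u by simp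
    ultimately show ?thesis by (intro mult_nonneg_nonneg) auto
  qed
  finally show "9 * b * d - 5 * a * c \<le> 27 * (1 - 2 * w) * d - 15 * a^2" by simp
  \<comment> \<open>By the Schur complement of the entry \<open>d / 5\<close>, this difference is
    \<open>5 * d\<close> times the determinant of the moment matrix; the cubic appears as a
    factor.\<close>
  have "((1 - 2 * w) * d - 5 * a^2 / 9) * (e * d / 5 - 5 * c^2 / 81) - (b * d / 3 - 5 * a * c / 27)^2
      = w^4 * (u - 6 + 4 * t) * 16 / 405 *
        ((u - 14/3)^3 - (78 * t^2 + 46) / 3 * (u - 14/3) - (2952 * t^2 - 488) / 27)"
    unfolding n a b c d e by (simp add: field_simps) algebra
  thus "((1 - 2 * w) * d - 5 * a^2 / 9) * (e * d / 5 - 5 * c^2 / 81) = (b * d / 3 - 5 * a * c / 27)^2"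
    unfolding cubic by simp
qed

text \<open>The squared nodes are \<open>(X, Y)\<close> and \<open>(0, Z)\<close>. The first five moments determine them and
  their weights; the singularity \<open>det\<close> then yields the sixth.\<close>

lemma two_node_moments:
  fixes m a b c d e :: real
  assumes pos: "a > 0" "c > 0" "d > 0" and x1: "3 * d \<le> 5 * a" and y1: "c \<le> 3 * a"
    and w2: "9 * m * d > 5 * a^2" and y2: "9 * b * d \<ge> 5 * a * c"
    "9 * b * d - 5 * a * c \<le> 27 * m * d - 15 * a^2"
    and det: "(m * d - 5 * a^2 / 9) * (e * d / 5 - 5 * c^2 / 81) = (b * d / 3 - 5 * a * c / 27)^2"
  defines "\<omega>1 \<equiv> 5 * a^2 / (9 * d)" and "X \<equiv> 3 * d / (5 * a)" and "Y \<equiv> c / (3 * a)"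
  defines "\<omega>2 \<equiv> m - \<omega>1"
  defines "Z \<equiv> (b - 3 * \<omega>1 * Y) / (3 * \<omega>2)"
  shows "\<omega>1 > 0" "\<omega>2 > 0" "0 < X" "X \<le> 1" "0 \<le> Y" "Y \<le> 1" "0 \<le> Z" "Z \<le> 1"
    "\<omega>1 * X = a / 3" "\<omega>1 * X^2 = d / 5" "\<omega>1 * (X * Y) = c / 9"
    "\<omega>1 * Y + \<omega>2 * Z = b / 3" "\<omega>1 * Y^2 + \<omega>2 * Z^2 = e / 5"
proof -
  show "\<omega>1 > 0" "0 < X" "X \<le> 1" "0 \<le> Y" "Y \<le> 1"
    using pos x1 y1 by (auto simp: \<omega>1_def X_def Y_def)
  \<comment> \<open>Multiplying by \<open>d\<close> clears the denominator of
    \<open>\<omega>1\<close> and produces the first factor of \<open>det\<close>.\<close>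
  have w2d: "\<omega>2 * d = m * d - 5 * a^2 / 9" using pos by (simp add: \<omega>2_def \<omega>1_def field_simps)
  hence "\<omega>2 * d > 0" using w2 by simp
  thus w2p: "\<omega>2 > 0" using pos by (simp add: zero_less_mult_iff)
  show "\<omega>1 * X = a / 3" "\<omega>1 * X^2 = d / 5" "\<omega>1 * (X * Y) = c / 9"
    using pos by (simp_all add: \<omega>1_def X_def Y_def field_simps power2_eq_square)
  have w1Y: "\<omega>1 * Y * d = 5 * a * c / 27" "\<omega>1 * Y^2 * d = 5 * c^2 / 81"
    using pos by (simp_all add: \<omega>1_def Y_def field_simps power2_eq_square)
  have Z: "\<omega>2 * Z = b / 3 - \<omega>1 * Y" using w2p by (simp add: Z_def field_simps)
  thus "\<omega>1 * Y + \<omega>2 * Z = b / 3" by simp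
  have Zd: "(\<omega>2 * Z) * d = b * d / 3 - 5 * a * c / 27"
    unfolding Z by (simp add: left_diff_distrib w1Y(1))
  hence "0 \<le> Z * (\<omega>2 * d)" using y2(1) by (simp add: mult_ac)
  thus "0 \<le> Z" using \<open>\<omega>2 * d > 0\<close> by (simp add: zero_le_mult_iff)
  have "Z * (\<omega>2 * d) \<le> 1 * (\<omega>2 * d)" using Zd y2(2) w2d by (simp add: mult_ac)
  thus "Z \<le> 1" using \<open>\<omega>2 * d > 0\<close> by (simp only: mult_le_cancel_right_pos)
  \<comment> \<open>In these terms \<open>det\<close> is the missing equation for y^4, multiplied by
    \<open>\<omega>2 * d * d\<close>.\<close>
  have "(\<omega>2 * d) * (e * d / 5 - \<omega>1 * Y^2 * d) = (\<omega>2 * Z * d)^2"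
    unfolding w2d Zd w1Y(2) by (rule det)
  hence "(\<omega>2 * d * d) * (e / 5 - \<omega>1 * Y^2) = (\<omega>2 * d * d) * (\<omega>2 * Z^2)"
    by (simp add: algebra_simps power2_eq_square)
  moreover have "\<omega>2 * d * d \<noteq> 0" using w2p pos by simp
  ultimately have "e / 5 - \<omega>1 * Y^2 = \<omega>2 * Z^2" by (metis mult_left_cancel)
  thus "\<omega>1 * Y^2 + \<omega>2 * Z^2 = e / 5" by simp
qed

section \<open>Assembling the OCAD from the two signs of \<theta>\<close>

lemma even_quadratic_in_polys2: "(\<lambda>(x, y). a + b * x\<^sup>2 + c * y\<^sup>2) \<in> polys 2"
proof -
  have "(\<lambda>z. (\<lambda>(x, y). a * x ^ 0 * y ^ 0) z + (\<lambda>(x, y). b * x ^ 2 * y ^ 0) z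
      + (\<lambda>(x, y). c * x ^ 0 * y ^ 2) z) \<in> polys 2"
    by (intro polys_add polys_monom) auto
  thus ?thesis by (simp add: case_prod_unfold)
qed

theorem theorem5p15:
  fixes \<theta> w \<omega>1 \<omega>2 :: real and k :: nat
  assumes "\<theta> \<in> {-1..1}"
    and "k \<in> {4, 5}"
    and "w = inverse (14/3 + 2/3 * sqrt (78 * \<theta>\<^sup>2 + 46) *
                cos (1/3 * arccos ((1476 * \<theta>\<^sup>2 - 244) / (78 * \<theta>\<^sup>2 + 46) powr (3/2))))"
    and "\<omega>1 = 5 * (1 - 4 * w + 2 * \<bar>\<theta>\<bar> * w)\<^sup>2 / (9 * (1 - 6 * w + 4 * \<bar>\<theta>\<bar> * w))"
    and "\<omega>2 = 1 - 2 * w - \<omega>1"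
  shows
    "(\<theta> \<in> {-1..0} \<longrightarrow>
       (let x1 = sqrt (3 * (1 - 6 * w + 4 * \<bar>\<theta>\<bar> * w) / (5 * (1 - 4 * w + 2 * \<bar>\<theta>\<bar> * w)));
            y1 = sqrt ((1 - 6 * w) / (3 * (1 - 4 * w + 2 * \<bar>\<theta>\<bar> * w)));
            x2 = 0;
            y2 = sqrt ((1 - 4 * w - 2 * \<bar>\<theta>\<bar> * w - 3 * \<omega>1 * y1\<^sup>2) / (3 * \<omega>2))
        in symmetric_OCAD \<theta> (polys k) w [(\<omega>1, x1, y1), (\<omega>2, x2, y2)])) \<and>
     (\<theta> \<in> {0..1} \<longrightarrow>
       (let x1 = sqrt ((1 - 6 * w) / (3 * (1 - 4 * w + 2 * \<bar>\<theta>\<bar> * w)));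
            y1 = sqrt (3 * (1 - 6 * w + 4 * \<bar>\<theta>\<bar> * w) / (5 * (1 - 4 * w + 2 * \<bar>\<theta>\<bar> * w)));
            x2 = sqrt ((1 - 4 * w - 2 * \<bar>\<theta>\<bar> * w - 3 * \<omega>1 * x1\<^sup>2) / (3 * \<omega>2));
            y2 = 0
        in symmetric_OCAD \<theta> (polys k) w [(\<omega>1, x1, y1), (\<omega>2, x2, y2)])) \<and>
     omega_star \<theta> (polys k) = w \<and>
     ereal (omega_star \<theta> (polys k)) = phi_star \<theta> (nonneg_polys k) \<and>
     phi_star \<theta> (nonneg_polys k) = phi_star \<theta> (squares (polys 2)) \<and>
     (\<exists>q \<in> polys 2 - {\<lambda>z. 0}. critical_positive_poly \<theta> k (\<lambda>z. (q z)\<^sup>2))"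
proof -
  \<comment> \<open>Exchanging x and y replaces \<theta> by -\<theta>, so only \<open>t\<close>
    enters the weights, and the two signs differ by a swap of node coordinates.\<close>
  define t where "t = \<bar>\<theta>\<bar>"
  have t: "0 \<le> t" "t \<le> 1" and t2: "t\<^sup>2 = \<theta>\<^sup>2" using assms(1) by (auto simp: t_def)
  define v where "v = 2/3 * sqrt (78 * \<theta>\<^sup>2 + 46) *
      cos (1/3 * arccos ((1476 * \<theta>\<^sup>2 - 244) / (78 * \<theta>\<^sup>2 + 46) powr (3/2)))"
  define u where "u = 14/3 + v"
  have "v^3 - (78 * t^2 + 46) / 3 * v = (2952 * t^2 - 488) / 27" "v > 31/12"
    unfolding t2 using trigonometric_cubic_root[OF _ v_def] by auto
  hence cubic: "(u - 14/3)^3 - (78 * t^2 + 46) / 3 * (u - 14/3) = (2952 * t^2 - 488) / 27"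
    and u: "u > 29/4" by (simp_all add: u_def)
  have w: "w = 1 / u" unfolding assms(3) u_def v_def by (simp add: inverse_eq_divide)
  hence w0: "w > 0" using u by simp
  define a b c d e where "a = 1 - 4 * w + 2 * t * w" and "b = 1 - 4 * w - 2 * t * w"
    and "c = 1 - 6 * w" and "d = 1 - 6 * w + 4 * t * w" and "e = 1 - 6 * w - 4 * t * w"
  note abcde = this
  define X Y Z where "X = 3 * d / (5 * a)" and "Y = c / (3 * a)"
    and "Z = (b - 3 * \<omega>1 * Y) / (3 * \<omega>2)"
  have \<omega>1: "\<omega>1 = 5 * a^2 / (9 * d)" by (simp add: assms(4) abcde t_def)
  note bounds = residual_moment_bounds[OF t u w cubic, folded abcde]
  note nodes = two_node_moments[OF bounds, folded \<omega>1, folded assms(5), folded X_def Y_def,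
      folded Z_def]
  \<comment> \<open>Feasibility in degree 5 restricts to degree 4, and squares of quadratics have
    degree at most 4, so both values of \<open>k\<close> are treated at once.\<close>
  have k: "polys k \<subseteq> polys 5" "2 * 2 \<le> k" using assms(2) by (auto intro!: polys_mono)
  have \<theta>: "\<bar>\<theta>\<bar> \<le> 1" using t by (simp add: t_def)
  have pow4: "sqrt r ^ 4 = r^2" if "r \<ge> 0" for r
    using that by (simp add: power4_eq_xxxx power2_eq_square)
  \<comment> \<open>The claims that do not mention nodes are bundled in, since each sign has to
    supply them too.\<close>
  let ?P = "\<lambda>ns. symmetric_OCAD \<theta> (polys k) w ns \<and> omega_star \<theta> (polys k) = w \<and>
     phi_star \<theta> (nonneg_polys k) = ereal w \<and> phi_star \<theta> (squares (polys 2)) = ereal w \<and>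
     (\<exists>q \<in> polys 2 - {\<lambda>z. 0}. critical_positive_poly \<theta> k (\<lambda>z. (q z)\<^sup>2))"
  have nonpos: "?P [(\<omega>1, sqrt X, sqrt Y), (\<omega>2, 0, sqrt Z)]" if "\<theta> \<le> 0"
  proof -
    have feas: "feasible_symmetric_CAD \<theta> (polys k) w [(\<omega>1, sqrt X, sqrt Y), (\<omega>2, 0, sqrt Z)]"
      by (rule feasible_symmetric_CAD_mono[OF feasible_symmetric_CAD_polys5 k(1)])
         (use nodes w0 that in \<open>auto simp: abcde t_def assms(5) pow4\<close>)
    \<comment> \<open>In squared coordinates \<open>q = 0\<close> is the line through
      \<open>(X, Y)\<close> and \<open>(0, Z)\<close>, hence \<open>q\<close> vanishes at both
      nodes.\<close>
    define q where "q = (\<lambda>(x, y). - X * Z + (Z - Y) * x\<^sup>2 + X * y\<^sup>2)"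
    have q: "q \<in> polys 2" unfolding q_def by (rule even_quadratic_in_polys2)
    \<comment> \<open>The values are \<open>- X * Z\<close> and \<open>X * (1 - Z)\<close>, which
      cannot both be zero as \<open>X > 0\<close>.\<close>
    have "q (0, 0) \<noteq> 0 \<or> q (0, 1) \<noteq> 0" using nodes by (auto simp: q_def)
    moreover have "(0, 0) \<in> Omega" "(0, 1) \<in> Omega" "(1, 0) \<in> Omega" by (auto simp: Omega_def)
    ultimately obtain z where z: "z \<in> Omega" "q z \<noteq> 0" by blast
    have "\<forall>(\<omega>, x, y)\<in>set [(\<omega>1, sqrt X, sqrt Y), (\<omega>2, 0, sqrt Z)]. sym_avg (\<lambda>z. (q z)\<^sup>2) x y = 0"
      using nodes by (auto simp: sym_avg_def q_def algebra_simps)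
    note ocad = OCAD_if_square_vanishes_at_nodes[OF feas \<theta> k(2) q z this]
    moreover have "q \<noteq> (\<lambda>z. 0)" using z by auto
    ultimately show ?thesis using q by blast
  qed
  have nonneg: "?P [(\<omega>1, sqrt Y, sqrt X), (\<omega>2, sqrt Z, 0)]" if "\<theta> \<ge> 0"
  proof -
    have feas: "feasible_symmetric_CAD \<theta> (polys k) w [(\<omega>1, sqrt Y, sqrt X), (\<omega>2, sqrt Z, 0)]"
      by (rule feasible_symmetric_CAD_mono[OF feasible_symmetric_CAD_polys5 k(1)])
         (use nodes w0 that in \<open>auto simp: abcde t_def assms(5) pow4 mult.commute[of Y X]\<close>)
    \<comment> \<open>The mirror image: the line through \<open>(Y, X)\<close> and
      \<open>(Z, 0)\<close>.\<close>
    define q where "q = (\<lambda>(x, y). - X * Z + X * x\<^sup>2 + (Z - Y) * y\<^sup>2)"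
    have q: "q \<in> polys 2" unfolding q_def by (rule even_quadratic_in_polys2)
    have "q (0, 0) \<noteq> 0 \<or> q (1, 0) \<noteq> 0" using nodes by (auto simp: q_def)
    moreover have "(0, 0) \<in> Omega" "(0, 1) \<in> Omega" "(1, 0) \<in> Omega" by (auto simp: Omega_def)
    ultimately obtain z where z: "z \<in> Omega" "q z \<noteq> 0" by blast
    have "\<forall>(\<omega>, x, y)\<in>set [(\<omega>1, sqrt Y, sqrt X), (\<omega>2, sqrt Z, 0)]. sym_avg (\<lambda>z. (q z)\<^sup>2) x y = 0"
      using nodes by (auto simp: sym_avg_def q_def algebra_simps)
    note ocad = OCAD_if_square_vanishes_at_nodes[OF feas \<theta> k(2) q z this]
    moreover have "q \<noteq> (\<lambda>z. 0)" using z by auto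
    ultimately show ?thesis using q by blast
  qed
  \<comment> \<open>The stated second node contains the square of the coordinate
    \<open>sqrt Y\<close> of the first; this turns its radicand into \<open>Z\<close>.\<close>
  have "sqrt Y ^ 2 = Y" using nodes by simp
  then show ?thesis
    using nonpos nonneg
    by (cases "\<theta> \<le> 0") (auto simp: Let_def X_def Y_def Z_def abcde t_def)
qed

end
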